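(* For any integers $n$ and $t$ with $1\le t\le n/2$, every $(n,t)$-selection network has size $\Omega((n-t)\log(t+1))$.
   Context: A comparator network on $n$ wires consists of comparators, each taking two wires as input and outputting the minimum on one designated output wire and the maximum on the other; it has $n$ inputs and $n$ outputs, indexed $0,\dots,n-1$. Its size is the number of comparators. An $(n,t)$-selection network is a comparator network on $n$ wires such that, for every input of $n$ values from a totally ordered set, output $0$ carries the $t$-th smallest input value. *)

theory Defs
  imports Complex_Main "HOL-Library.Multiset"
begin

text \<open>
  The comparator \<open>(i, j)\<close> writes the minimum to wire \<open>i\<close> and the maximum to wire \<open>j\<close>. No
  relation between \<open>i\<close> and \<open>j\<close> is required beyond \<open>i \<noteq> j\<close>, so either of the two wires may be the
  one designated for the minimum. A network lists its comparators in an order of evaluation; its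
  size is the length of the list.
\<close>

type_synonym comparator = "nat \<times> nat"

definition comparator_network :: "nat \<Rightarrow> comparator list \<Rightarrow> bool" where
  "comparator_network n C \<longleftrightarrow> (\<forall>(i, j)\<in>set C. i < n \<and> j < n \<and> i \<noteq> j)"

definition apply_comparator :: "comparator \<Rightarrow> (nat \<Rightarrow> 'a::linorder) \<Rightarrow> nat \<Rightarrow> 'a" where
  "apply_comparator = (\<lambda>(i, j) x. x(i := min (x i) (x j), j := max (x i) (x j)))"

definition run_network :: "comparator list \<Rightarrow> (nat \<Rightarrow> 'a::linorder) \<Rightarrow> nat \<Rightarrow> 'a" where
  "run_network C x = fold apply_comparator C x"

text \<open>Counted with multiplicity and from \<open>1\<close>; meaningful for \<open>1 \<le> t \<le> n\<close>.\<close>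

definition nth_smallest :: "nat \<Rightarrow> nat \<Rightarrow> (nat \<Rightarrow> 'a::linorder) \<Rightarrow> 'a" where
  "nth_smallest n t x = sort (map x [0..<n]) ! (t - 1)"

definition selects :: "'a::linorder itself \<Rightarrow> nat \<Rightarrow> nat \<Rightarrow> comparator list \<Rightarrow> bool" where
  "selects _ n t C \<longleftrightarrow> (\<forall>x :: nat \<Rightarrow> 'a. run_network C x 0 = nth_smallest n t x)"

text \<open>
  A definition cannot quantify over all linearly ordered types. It is enough to take inputs from
  \<^typ>\<open>nat\<close>: by \<open>selection_network_selects\<close> below, the network then selects correctly on inputs
  from every linear order.
\<close>

definition selection_network :: "nat \<Rightarrow> nat \<Rightarrow> comparator list \<Rightarrow> bool" where
  "selection_network n t C \<longleftrightarrow> comparator_network n C \<and> selects TYPE(nat) n t C"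

lemma apply_comparator_mono:
  assumes "mono f"
  shows "apply_comparator c (f \<circ> x) = f \<circ> apply_comparator c x"
  using assms
  by (auto simp: apply_comparator_def fun_eq_iff min_of_mono max_of_mono split: prod.split)

lemma run_network_mono:
  assumes "mono f"
  shows "run_network C (f \<circ> x) = f \<circ> run_network C x"
  unfolding run_network_def
  by (induction C arbitrary: x) (simp_all add: apply_comparator_mono[OF assms])

lemma sort_map_mono:
  assumes "mono f"
  shows "sort (map f xs) = map f (sort xs)"
proof (rule properties_for_sort)
  show "mset (map f (sort xs)) = mset (map f xs)"
    by simp
  show "sorted (map f (sort xs))"
    using assms by (auto simp: sorted_map mono_def intro: sorted_wrt_mono_rel[OF _ sorted_sort])
qed

lemma nth_smallest_mono:
  assumes "mono f" "1 \<le> t" "t \<le> n"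
  shows "nth_smallest n t (f \<circ> x) = f (nth_smallest n t x)"
  using assms sort_map_mono[OF assms(1), of "map x [0..<n]"]
  by (simp add: nth_smallest_def)

lemma run_network_in_range:
  assumes "comparator_network n C" "k < n"
  shows "run_network C x k \<in> x ` {..<n}"
  using assms
proof (induction C arbitrary: x)
  case Nil
  then show ?case by (simp add: run_network_def)
next
  case (Cons c C)
  obtain i j where c: "c = (i, j)" by (cases c)
  from Cons.prems c have ij: "i < n" "j < n"
    by (auto simp: comparator_network_def)
  have "apply_comparator c x ` {..<n} \<subseteq> x ` {..<n}"
    using ij by (auto simp: apply_comparator_def c min_def max_def)
  moreover have "run_network C (apply_comparator c x) k \<in> apply_comparator c x ` {..<n}"
    using Cons by (auto simp: comparator_network_def)
  ultimately show ?case by (auto simp: run_network_def)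
qed

lemma nth_smallest_in_range:
  assumes "1 \<le> t" "t \<le> n"
  shows "nth_smallest n t x \<in> x ` {..<n}"
proof -
  have "nth_smallest n t x \<in> set (sort (map x [0..<n]))"
    unfolding nth_smallest_def using assms by (intro nth_mem) simp
  then show ?thesis by (auto simp: atLeast0LessThan)
qed

theorem selection_network_selects:
  assumes "selection_network n t C" "1 \<le> t" "t \<le> n"
  shows "selects TYPE('a::linorder) n t C"
  unfolding selects_def
proof
  fix x :: "nat \<Rightarrow> 'a"
  define S where "S = x ` {..<n}"
  define f where "f v = card {w \<in> S. w < v}" for v
  have fin: "finite S" by (simp add: S_def)
  have "mono f"
    unfolding f_def by (intro monoI card_mono) (use fin in auto)
  have less: "f u < f v" if "u < v" "u \<in> S" for u v
    unfolding f_def by (rule psubset_card_mono) (use fin that in auto)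
  have inj: "u = v" if "f u = f v" "u \<in> S" "v \<in> S" for u v
    using less[of u v] less[of v u] that by (cases u v rule: linorder_cases) auto
  have net: "comparator_network n C"
    using assms by (simp add: selection_network_def)
  have "run_network C (f \<circ> x) 0 = nth_smallest n t (f \<circ> x)"
    using assms by (simp add: selection_network_def selects_def)
  then have "f (run_network C x 0) = f (nth_smallest n t x)"
    using assms by (simp add: run_network_mono[OF \<open>mono f\<close>] nth_smallest_mono[OF \<open>mono f\<close>])
  moreover have "run_network C x 0 \<in> S"
    unfolding S_def by (rule run_network_in_range[OF net]) (use assms in simp)
  moreover have "nth_smallest n t x \<in> S"
    unfolding S_def by (rule nth_smallest_in_range) (use assms in simp_all)
  ultimately show "run_network C x 0 = nth_smallest n t x"
    by (rule inj)
qed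

end

theory Submission
  imports Defs
begin

text \<open>
  Feed the network inputs from \<open>{0, 1}\<close>. Adding one zero to an input with \<open>t - 1\<close> zeros flips
  exactly one output, which must be output \<open>0\<close>; all other outputs are unaffected. Since any two
  \<open>t\<close>-subsets are connected by exchanges of single elements, all inputs with exactly \<open>t\<close> zeros
  produce the same output, and so \<open>n - t\<close> fixed output wires carry \<open>1\<close> on all of them. None of
  these wires can be forced to \<open>0\<close> by at most \<open>t\<close> zeros in the input.

  On the other hand, if \<open>a\<close> and \<open>b\<close> zeros suffice to force the two inputs of a comparator to
  \<open>0\<close>, then \<open>min a b\<close> zeros suffice for its minimum and \<open>a + b\<close> for its maximum. As
  \<open>min a b * (a + b) \<le> 2 * a * b\<close>, the sum over all wires of the binary logarithms of these
  numbers grows by at most \<open>1\<close> per comparator. It starts at \<open>0\<close> and ends at no less than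
  \<open>(n - t) * log 2 (t + 1)\<close> (an argument of Alekseev).
\<close>

section \<open>Comparator networks on zero-one inputs\<close>

definition zeros_on :: "nat set \<Rightarrow> nat \<Rightarrow> nat" where
  "zeros_on S i = (if i \<in> S then 0 else 1)"

lemma run_network_Nil [simp]: "run_network [] x = x"
  by (simp add: run_network_def)

lemma run_network_Cons [simp]:
  "run_network (c # C) x = run_network C (apply_comparator c x)"
  by (simp add: run_network_def)

lemma run_network_snoc [simp]:
  "run_network (C @ [c]) x = apply_comparator c (run_network C x)"
  by (simp add: run_network_def)

lemma comparator_network_snoc [simp]:
  "comparator_network n (C @ [(i, j)]) \<longleftrightarrow> comparator_network n C \<and> i < n \<and> j < n \<and> i \<noteq> j"
  by (auto simp: comparator_network_def)

lemma run_network_le: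
  assumes "x \<le> y"
  shows "run_network C x \<le> run_network C y"
  using assms
proof (induction C arbitrary: x y)
  case (Cons c C)
  have "apply_comparator c x \<le> apply_comparator c y"
    using Cons.prems
    by (auto simp: apply_comparator_def le_fun_def split: prod.split
        intro: min.coboundedI1 min.coboundedI2 max.coboundedI1 max.coboundedI2)
  then show ?case by (simp add: Cons.IH)
qed simp

lemma sum_split_two:
  fixes f :: "nat \<Rightarrow> 'a::comm_monoid_add"
  assumes "i < n" "j < n" "i \<noteq> j"
  shows "sum f {..<n} = f i + f j + sum f ({..<n} - {i, j})"
proof -
  have "sum f {..<n} = sum f {i, j} + sum f ({..<n} - {i, j})"
    using assms by (subst add.commute, intro sum.subset_diff) auto
  then show ?thesis using assms by simp
qed

text \<open>A comparator only permutes the values on its two wires. On zero-one inputs the sum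
  counts the ones, so this controls how many outputs carry 1.\<close>

lemma sum_run_network:
  fixes x :: "nat \<Rightarrow> nat"
  assumes "comparator_network n C"
  shows "sum (run_network C x) {..<n} = sum x {..<n}"
  using assms
proof (induction C rule: rev_induct)
  case (snoc c C)
  obtain i j where c: "c = (i, j)" by (cases c)
  then have ij: "i < n" "j < n" "i \<noteq> j" using snoc.prems by simp_all
  have "sum (apply_comparator c y) {..<n} = sum y {..<n}" for y :: "nat \<Rightarrow> nat"
    unfolding sum_split_two[OF ij] by (auto simp: c apply_comparator_def ij min_def max_def)
  then show ?case using snoc c by simp
qed simp

lemma sum_zeros_on:
  assumes "S \<subseteq> {..<n}"
  shows "sum (zeros_on S) {..<n} = n - card S"
proof -
  have "sum (zeros_on S) {..<n} = sum (\<lambda>_. 1) ({..<n} - S)"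
    by (rule sum.mono_neutral_cong_right) (auto simp: zeros_on_def)
  also have "\<dots> = n - card S"
    using assms by (simp add: card_Diff_subset finite_subset)
  finally show ?thesis .
qed

lemma nth_smallest_zeros_on:
  assumes "S \<subseteq> {..<n}" "1 \<le> t" "t \<le> n"
  shows "nth_smallest n t (zeros_on S) = (if t \<le> card S then 0 else 1)"
proof -
  let ?ys = "replicate (card S) 0 @ replicate (n - card S) (1::nat)"
  have "sort (map (zeros_on S) [0..<n]) = ?ys"
  proof (rule properties_for_sort)
    have fin: "finite S" using assms by (auto intro: finite_subset)
    have "mset_set {..<n} = mset_set S + mset_set ({..<n} - S)"
      using assms fin by (subst mset_set_Union[symmetric]) (auto simp: Un_absorb1)
    then have "mset (map (zeros_on S) [0..<n]) =
        image_mset (zeros_on S) (mset_set S) + image_mset (zeros_on S) (mset_set ({..<n} - S))"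
      by (simp add: atLeast0LessThan)
    also have "image_mset (zeros_on S) (mset_set S) = image_mset (\<lambda>_. 0) (mset_set S)"
      by (rule image_mset_cong) (auto simp: zeros_on_def fin)
    also have "image_mset (zeros_on S) (mset_set ({..<n} - S)) =
        image_mset (\<lambda>_. 1) (mset_set ({..<n} - S))"
      by (rule image_mset_cong) (auto simp: zeros_on_def)
    finally show "mset ?ys = mset (map (zeros_on S) [0..<n])"
      using assms fin by (simp add: image_mset_const_eq card_Diff_subset)
  qed (auto simp: sorted_append)
  then show ?thesis
    using assms by (auto simp: nth_smallest_def nth_append)
qed

section \<open>Selection determines the set of large outputs\<close>

text \<open>By monotonicity no output rises when a zero is added, while the sum of the outputs drops
  by exactly 1. Output \<open>0\<close> already accounts for this drop, as selection makes it fall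
  from 1 to 0.\<close>

lemma run_network_insert_zero:
  assumes sel: "selection_network n t C" and t: "1 \<le> t" "t \<le> n"
    and S: "S \<subseteq> {..<n}" "card S = t - 1" and i: "i < n" "i \<notin> S" and w: "w < n" "w \<noteq> 0"
  shows "run_network C (zeros_on (insert i S)) w = run_network C (zeros_on S) w"
proof -
  let ?g = "\<lambda>S. run_network C (zeros_on S)"
  have net: "comparator_network n C" and out: "\<And>x :: nat \<Rightarrow> nat. run_network C x 0 = nth_smallest n t x"
    using sel by (auto simp: selection_network_def selects_def)
  have fin: "finite S" using S by (auto intro: finite_subset)
  have iS: "insert i S \<subseteq> {..<n}" "card (insert i S) = t" using S i t fin by auto
  have z: "?g S 0 = 1" "?g (insert i S) 0 = 0"
    unfolding out using S iS t by (simp_all add: nth_smallest_zeros_on)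
  have le: "?g (insert i S) v \<le> ?g S v" for v
    using run_network_le[of "zeros_on (insert i S)" "zeros_on S" C]
    by (auto simp: le_fun_def zeros_on_def)
  have sums: "sum (?g S) {..<n} = n - (t - 1)" "sum (?g (insert i S)) {..<n} = n - t"
    using sum_run_network[OF net] sum_zeros_on S iS by auto
  have n0: "0 < n" using t by simp
  have "sum (?g S) ({..<n} - {0, w}) \<ge> sum (?g (insert i S)) ({..<n} - {0, w})"
    by (intro sum_mono le)
  then show ?thesis
    using sums z le[of w] t sum_split_two[OF n0 w(1), of "?g S"]
      sum_split_two[OF n0 w(1), of "?g (insert i S)"] w by simp
qed

lemma run_network_zeros_on_eq:
  assumes sel: "selection_network n t C" and t: "1 \<le> t" "t \<le> n" and w: "w < n"
    and "S \<subseteq> {..<n}" "card S = t" "T \<subseteq> {..<n}" "card T = t"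
  shows "run_network C (zeros_on S) w = run_network C (zeros_on T) w"
proof (cases "w = 0")
  case True
  then show ?thesis
    using assms by (simp add: selection_network_def selects_def nth_smallest_zeros_on)
next
  case False
  show ?thesis using assms(5-8)
  proof (induction "card (T - S)" arbitrary: S)
    case 0
    have "finite S" "finite T" using "0.prems" by (auto intro: finite_subset)
    then have "T = S" using 0 by (intro card_subset_eq) auto
    then show ?case by simp
  next
    case (Suc k)
    have fin: "finite S" "finite T" using Suc.prems by (auto intro: finite_subset)
    \<comment> \<open>Equal cardinality makes \<open>S - T\<close> nonempty along with
      \<open>T - S\<close>, so some \<open>j\<close> can be exchanged for \<open>i\<close>. Both
      sides of the exchange add one zero to the common set \<open>R\<close> of size
      \<open>t - 1\<close>.\<close>
    have "card (S - T) = card (T - S)"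
      using fin Suc.prems card_Diff_subset_Int[of S T] card_Diff_subset_Int[of T S]
      by (simp add: Int_commute)
    then obtain i j where i: "i \<in> T" "i \<notin> S" and j: "j \<in> S" "j \<notin> T"
      using Suc.hyps(2) fin by (metis DiffE card_gt_0_iff ex_in_conv zero_less_Suc)
    define R where "R = S - {j}"
    have R: "R \<subseteq> {..<n}" "card R = t - 1" "i \<notin> R" "j \<notin> R" "finite R" "insert j R = S"
      using Suc.prems i j fin by (auto simp: R_def)
    have "T - insert i R = (T - S) - {i}" using i j by (auto simp: R_def)
    then have "k = card (T - insert i R)" using Suc.hyps(2) i fin by simp
    moreover have "i < n" "j < n" using i j Suc.prems by auto
    moreover have "card (insert i R) = t" using R t by simp
    ultimately have "run_network C (zeros_on (insert i R)) w = run_network C (zeros_on T) w"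
      using Suc.hyps(1)[of "insert i R"] R Suc.prems by simp
    moreover have "run_network C (zeros_on (insert i R)) w = run_network C (zeros_on (insert j R)) w"
      using run_network_insert_zero[OF sel t R(1,2) _ _ w False] R(3,4) \<open>i < n\<close> \<open>j < n\<close> by simp
    ultimately show ?case using R by simp
  qed
qed

text \<open>The input with zeros on \<open>{..<t}\<close> serves as reference: its outputs are 0 or
  1 and sum to \<open>n - t\<close>, so that many wires carry 1, and every other
  \<open>t\<close>-subset gives the same outputs.\<close>

lemma selection_network_large_outputs:
  assumes sel: "selection_network n t C" and t: "1 \<le> t" "t \<le> n"
  obtains L where "L \<subseteq> {..<n}" "card L = n - t"
    "\<And>S w. S \<subseteq> {..<n} \<Longrightarrow> card S = t \<Longrightarrow> w \<in> L \<Longrightarrow> run_network C (zeros_on S) w = 1"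
proof
  let ?g = "run_network C (zeros_on {..<t})"
  let ?L = "{w \<in> {..<n}. ?g w = 1}"
  have net: "comparator_network n C" using sel by (simp add: selection_network_def)
  have "?g w \<in> {0, 1}" if "w < n" for w
    using run_network_in_range[OF net that, of "zeros_on {..<t}"] by (auto simp: zeros_on_def)
  then have "sum ?g {..<n} = sum (\<lambda>_. 1) ?L"
    by (intro sum.mono_neutral_cong_right) fastforce+
  then show "card ?L = n - t"
    using sum_run_network[OF net, of "zeros_on {..<t}"] sum_zeros_on[of "{..<t}" n] t by simp
  show "run_network C (zeros_on S) w = 1" if "S \<subseteq> {..<n}" "card S = t" "w \<in> ?L" for S w
    using run_network_zeros_on_eq[OF sel t, of w S "{..<t}"] that t by auto
qed auto

section \<open>The number of zeros forcing a wire\<close>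

text \<open>The values outside \<open>S\<close> are arbitrary, so additional zeros do no harm.
  Zero-one inputs are the case \<open>v = 0\<close>.\<close>

definition forces :: "comparator list \<Rightarrow> nat set \<Rightarrow> nat \<Rightarrow> bool" where
  "forces C S w \<longleftrightarrow>
    (\<forall>(x :: nat \<Rightarrow> nat) v. (\<forall>i\<in>S. x i \<le> v) \<longrightarrow> run_network C x w \<le> v)"

text \<open>This tracks an upper bound for the size of a smallest forcing set: the sets for the two
  inputs may overlap, yet their sizes are added.\<close>

definition forcing_step :: "comparator \<Rightarrow> (nat \<Rightarrow> nat) \<Rightarrow> nat \<Rightarrow> nat" where
  "forcing_step = (\<lambda>(i, j) a. a(i := min (a i) (a j), j := a i + a j))"

definition forcing :: "comparator list \<Rightarrow> nat \<Rightarrow> nat" where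
  "forcing C = fold forcing_step C (\<lambda>_. 1)"

lemma forcing_Nil [simp]: "forcing [] w = 1"
  by (simp add: forcing_def)

lemma forcing_snoc [simp]: "forcing (C @ [c]) = forcing_step c (forcing C)"
  by (simp add: forcing_def)

lemma forcing_pos: "forcing C w \<ge> 1"
proof (induction C arbitrary: w rule: rev_induct)
  case (snoc c C)
  then show ?case
    using snoc[of "fst c"] snoc[of "snd c"] by (auto simp: forcing_step_def intro: trans_le_add1 split: prod.split)
qed simp

text \<open>A minimum is small once either input is, so the set with the smaller bound is kept. A
  maximum needs both inputs small, hence the union.\<close>

lemma forcing_set_exists:
  assumes "comparator_network n C" "w < n"
  shows "\<exists>S \<subseteq> {..<n}. card S \<le> forcing C w \<and> forces C S w"
  using assms
proof (induction C arbitrary: w rule: rev_induct)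
  case Nil
  then show ?case by (intro exI[of _ "{w}"]) (auto simp: forces_def)
next
  case (snoc c C)
  obtain i j where c: "c = (i, j)" by (cases c)
  then have net: "comparator_network n C" and ij: "i < n" "j < n" "i \<noteq> j"
    using snoc.prems by simp_all
  obtain A where A: "A \<subseteq> {..<n}" "card A \<le> forcing C i" "forces C A i"
    using snoc.IH[OF net ij(1)] by blast
  obtain B where B: "B \<subseteq> {..<n}" "card B \<le> forcing C j" "forces C B j"
    using snoc.IH[OF net ij(2)] by blast
  consider "w = i" | "w = j" | "w \<noteq> i" "w \<noteq> j" by blast
  then show ?case
  proof cases
    case 1
    show ?thesis
    proof (cases "forcing C i \<le> forcing C j")
      case True
      with 1 A ij show ?thesis
        by (intro exI[of _ A]) (auto simp: c forces_def apply_comparator_def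
            forcing_step_def min_le_iff_disj)
    next
      case False
      with 1 B ij show ?thesis
        by (intro exI[of _ B]) (auto simp: c forces_def apply_comparator_def
            forcing_step_def min_le_iff_disj)
    qed
  next
    case 2
    have "card (A \<union> B) \<le> forcing C i + forcing C j"
      using card_Un_le[of A B] A(2) B(2) by linarith
    with 2 A B show ?thesis
      by (intro exI[of _ "A \<union> B"]) (auto simp: c forces_def apply_comparator_def forcing_step_def)
  next
    case 3
    then show ?thesis
      using snoc.IH[OF net snoc.prems(2)] by (simp add: c forces_def apply_comparator_def forcing_step_def)
  qed
qed

lemma sum_log_forcing_le:
  assumes "comparator_network n C"
  shows "(\<Sum>w<n. log 2 (forcing C w)) \<le> length C"
  using assms
proof (induction C rule: rev_induct)
  case (snoc c C)
  obtain i j where c: "c = (i, j)" by (cases c)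
  then have net: "comparator_network n C" and ij: "i < n" "j < n" "i \<noteq> j"
    using snoc.prems by simp_all
  define a b where "a = forcing C i" and "b = forcing C j"
  have pos: "a \<ge> 1" "b \<ge> 1" unfolding a_def b_def by (rule forcing_pos)+
  \<comment> \<open>The sum is at most twice the larger of \<open>a\<close> and \<open>b\<close>.
    The factor 2 becomes the increase by 1 after taking logarithms.\<close>
  have "min a b * (a + b) \<le> 2 * a * b"
    by (auto simp: min_def algebra_simps)
  then have "real (min a b) * real (a + b) \<le> 2 * real a * real b"
    by (metis of_nat_le_iff of_nat_mult of_nat_numeral)
  then have "log 2 (real (min a b) * real (a + b)) \<le> log 2 (2 * real a * real b)"
    using pos by (subst log_le_cancel_iff) auto
  then have "log 2 (min a b) + log 2 (a + b) \<le> log 2 a + log 2 b + 1"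
    using pos by (simp add: log_mult min_def split: if_splits)
  moreover have "(\<Sum>w<n. log 2 (forcing (C @ [c]) w)) =
      log 2 (min a b) + log 2 (a + b) + (\<Sum>w\<in>{..<n} - {i, j}. log 2 (forcing C w))"
    unfolding sum_split_two[OF ij] using ij by (simp add: c forcing_step_def a_def b_def)
  moreover have "(\<Sum>w<n. log 2 (forcing C w)) =
      log 2 a + log 2 b + (\<Sum>w\<in>{..<n} - {i, j}. log 2 (forcing C w))"
    unfolding sum_split_two[OF ij] by (simp add: a_def b_def)
  ultimately show ?case using snoc.IH[OF net] by simp
qed simp

lemma selection_network_size:
  assumes sel: "selection_network n t C" and t: "1 \<le> t" "t \<le> n"
  shows "(real n - real t) * log 2 (real t + 1) \<le> real (length C)"
proof -
  have net: "comparator_network n C" using sel by (simp add: selection_network_def)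
  obtain L where L: "L \<subseteq> {..<n}" "card L = n - t"
    and large: "\<And>S w. S \<subseteq> {..<n} \<Longrightarrow> card S = t \<Longrightarrow> w \<in> L \<Longrightarrow> run_network C (zeros_on S) w = 1"
    using selection_network_large_outputs[OF sel t] by blast
  have "t + 1 \<le> forcing C w" if w: "w \<in> L" for w
  proof (rule ccontr)
    assume "\<not> t + 1 \<le> forcing C w"
    moreover obtain S where S: "S \<subseteq> {..<n}" "card S \<le> forcing C w" "forces C S w"
      using forcing_set_exists[OF net, of w] w L by blast
    \<comment> \<open>A forcing set of size at most \<open>t\<close> is padded to exactly
      \<open>t\<close> zeros, where wires in \<open>L\<close> are known to carry 1.\<close>
    ultimately obtain T where T: "S \<subseteq> T" "T \<subseteq> {..<n}" "card T = t"
      using exists_subset_between[of S t "{..<n}"] t by auto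
    have "run_network C (zeros_on T) w \<le> 0"
      using T(1) S(3)[unfolded forces_def, rule_format, of "zeros_on T" 0]
      by (simp add: zeros_on_def subset_iff)
    with large[OF T(2,3) w] show False by simp
  qed
  then have "real t + 1 \<le> real (forcing C w)" if "w \<in> L" for w
    using that by fastforce
  then have "log 2 (real t + 1) \<le> log 2 (forcing C w)" if "w \<in> L" for w
    using that by (intro log_mono) auto
  then have "(\<Sum>w\<in>L. log 2 (real t + 1)) \<le> (\<Sum>w\<in>L. log 2 (forcing C w))"
    by (rule sum_mono)
  \<comment> \<open>Wires outside \<open>L\<close> contribute nonnegative terms, since
    \<open>forcing\<close> is at least 1.\<close>
  also have "\<dots> \<le> (\<Sum>w<n. log 2 (forcing C w))"
  proof (rule sum_mono2)
    show "0 \<le> log 2 (forcing C w)" for w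
      using forcing_pos[of C w] by simp
  qed (use L in auto)
  also have "\<dots> \<le> length C" by (rule sum_log_forcing_le[OF net])
  finally show ?thesis using L t by (simp add: of_nat_diff)
qed

theorem theorem19:
  "\<exists>c::real. c > 0 \<and>
     (\<forall>(n::nat) (t::nat) C. 1 \<le> t \<and> real t \<le> real n / 2 \<and> selection_network n t C \<longrightarrow>
        real (length C) \<ge> c * ((real n - real t) * log 2 (real t + 1)))"
proof (intro exI[of _ 1] conjI allI impI)
  \<comment> \<open>The constant 1 suffices because each comparator adds at most 1 to the sum of the
    binary logarithms.\<close>
  fix n t :: nat and C
  assume *: "1 \<le> t \<and> real t \<le> real n / 2 \<and> selection_network n t C"
  then have "t \<le> n" by linarith
  with * show "real (length C) \<ge> 1 * ((real n - real t) * log 2 (real t + 1))"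
    using selection_network_size by simp
qed simp

end
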